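(* Let $k\ge 2$ and let $Q_n=Q_n^{(k)}:=L_{-n}^{(k)}$ for $n\in\mathbb{Z}$. Then: (i) $Q_{mk+r}=0$ for all integers $0\le m<r\le k-2$; (ii) $Q_{mk-1}=-2^{m-1}$ for all integers $m\in[1,k-2]$; (iii) $Q_{mk+r}=(-1)^r\left[\psi(m-1,r-1)2^{m-r}+\psi(m-1,r)2^{m-r-2}\right]$ for all integers $0\le r\le m\le k-2$ with $m\ge 1$; (iv) for all integers $r\in[-1,k-2]$ and $m\ge \max\{1,k-2\}$, $$Q_{mk+r}=\sum_{i=0}^{l}(-1)^{ik+r}\left[\psi(m-i-1,ik+r-1)\,2^{m-i(k+1)-r}+\psi(m-i-1,ik+r)\,2^{m-i(k+1)-r-2}\right],$$ where $l=m$ if $k=2$ and $l=\lfloor (m+1)/(k-1)\rfloor$ if $k>2$.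
   Context: For an integer $k\ge 2$, the $k$-generalized Lucas sequence is defined by $L_0^{(k)}=2$, $L_1^{(k)}=1$, $L_n^{(k)}=0$ for $-(k-2)\le n\le -1$, and $L_n^{(k)}=\sum_{j=1}^{k}L_{n-j}^{(k)}$ for $n\ge 2$, extended to all negative indices by $L_{n-k}^{(k)}=L_n^{(k)}-L_{n-1}^{(k)}-\cdots-L_{n-(k-1)}^{(k)}$ for all integers $n$. (Equivalently, $Q_0=2$, $Q_i=0$ for $1\le i\le k-2$, $Q_{k-1}=-1$, and $Q_n=Q_{n-k}-Q_{n-(k-1)}-\cdots-Q_{n-1}$ for $n\ge k$.) For integers $a,b$ with $a\ge -1$, the binomial coefficient $\binom{a}{b}$ equals $\frac{a!}{b!(a-b)!}$ if $0\le b\le a$ and $0$ otherwise. Define $\psi(y,z)=\binom{y}{z}+\binom{y+1}{z+1}$; in particular $\psi(y,-1)=1$ and $\psi(y,z)=0$ whenever $z>y$. *)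

theory Defs
  imports Complex_Main
begin

text \<open>The \<open>k\<close>-generalized Lucas sequence on all of \<open>\<int>\<close>.
  The recurrence is used forwards for \<open>n \<ge> 2\<close> and, solved for its last term and shifted by \<open>k\<close>,
  backwards for \<open>n < -(k - 2)\<close>.  The value \<open>0\<close> for \<open>k < 2\<close> is a dummy.\<close>

function lucas :: "nat \<Rightarrow> int \<Rightarrow> int" where
  "lucas k n =
    (if k < 2 then 0
     else if n \<ge> 2 then (\<Sum>j = 1..k. lucas k (n - int j))
     else if n < - (int k - 2) then lucas k (n + int k) - (\<Sum>j = 1..k - 1. lucas k (n + int k - int j))
     else if n = 0 then 2
     else if n = 1 then 1
     else 0)"
  by pat_completeness auto

termination
  by (relation "measure (\<lambda>(k, n). nat (if n \<ge> 2 then n - 1 else if n < 2 - int k then 2 - int k - n else 0))")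
    auto

declare lucas.simps [simp del]

lemma lucas_0: "k \<ge> 2 \<Longrightarrow> lucas k 0 = 2"
  by (subst lucas.simps) auto

lemma lucas_1: "k \<ge> 2 \<Longrightarrow> lucas k 1 = 1"
  by (subst lucas.simps) auto

lemma lucas_initial: "k \<ge> 2 \<Longrightarrow> - (int k - 2) \<le> n \<Longrightarrow> n \<le> -1 \<Longrightarrow> lucas k n = 0"
  by (subst lucas.simps) auto

lemma lucas_forward:
  assumes "k \<ge> 2"
  shows "lucas k n = (\<Sum>j = 1..k. lucas k (n - int j))"
proof (cases "n \<ge> 2")
  case True
  then show ?thesis using assms by (subst lucas.simps) auto
next
  case False
  obtain k' where k': "k = Suc k'" using assms by (cases k) auto
  have "lucas k (n - int k) = lucas k n - (\<Sum>j = 1..k - 1. lucas k (n - int j))"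
    using False assms by (subst lucas.simps) auto
  then show ?thesis by (simp add: k')
qed

lemma lucas_backward:
  assumes "k \<ge> 2"
  shows "lucas k (n - int k) = lucas k n - (\<Sum>j = 1..k - 1. lucas k (n - int j))"
proof -
  obtain k' where k': "k = Suc k'" using assms by (cases k) auto
  show ?thesis using lucas_forward[OF assms, of n] by (simp add: k')
qed

definition lucas_neg :: "nat \<Rightarrow> int \<Rightarrow> int" where
  "lucas_neg k n = lucas k (- n)"

text \<open>Only the case \<open>a \<ge> -1\<close> is meaningful.\<close>

definition ibinom :: "int \<Rightarrow> int \<Rightarrow> int" where
  "ibinom a b = (if 0 \<le> b \<and> b \<le> a then int (nat a choose nat b) else 0)"

definition psi :: "int \<Rightarrow> int \<Rightarrow> int" where
  "psi y z = ibinom y z + ibinom (y + 1) (z + 1)"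

end

theory Submission
  imports Defs
begin

text \<open>Subtracting two consecutive instances of the defining recurrence gives
  \<open>Q n = 2 Q (n - k) - Q (n - k - 1)\<close>. The summand \<open>psi_term p s\<close> satisfies the matching Pascal-type rule
  \<open>psi_term p s = 2 psi_term (p - 1) s - psi_term (p - 1) (s - 1)\<close> for \<open>p \<ge> 2\<close> and vanishes unless \<open>-1 \<le> s \<le> p\<close>.
  Hence the sum of \<open>psi_term p s\<close> over all ways of writing \<open>n = p k + s\<close> with \<open>p \<ge> 0\<close> obeys the same recurrence
  as \<open>Q\<close> from \<open>n = k + 2\<close> on, and the two agree for \<open>1 \<le> n \<le> k + 1\<close>. The four formulas differ only
  in which of these representations contribute.\<close>

section \<open>Pascal rules and the summand\<close>

text \<open>The bound on \<open>a\<close> excludes \<open>a = b = 0\<close>, where the left side is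
  1 and both terms on the right are 0 by convention.\<close>

lemma ibinom_pascal:
  assumes "a \<ge> 1"
  shows "ibinom a b = ibinom (a - 1) b + ibinom (a - 1) (b - 1)"
proof (cases "1 \<le> b \<and> b \<le> a")
  case True
  obtain n where n: "a = int n + 1" using assms by (metis zle_iff_zadd add.commute)
  obtain j where j: "b = int j + 1" using True by (metis zle_iff_zadd add.commute)
  have "nat (int n + 1) = Suc n" "nat (int j + 1) = Suc j" by auto
  then show ?thesis using True by (auto simp: ibinom_def n j)
next
  case False
  then show ?thesis using assms by (auto simp: ibinom_def)
qed

lemma psi_pascal:
  assumes "y \<ge> 1"
  shows "psi y z = psi (y - 1) z + psi (y - 1) (z - 1)"
  using ibinom_pascal[of y z] ibinom_pascal[of "y + 1" "z + 1"] assms by (simp add: psi_def)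

lemma psi_eq_0: "z < -1 \<or> z > y \<Longrightarrow> psi y z = 0"
  by (auto simp: psi_def ibinom_def)

lemma psi_minus_1: "y \<ge> -1 \<Longrightarrow> psi y (-1) = 1"
  by (auto simp: psi_def ibinom_def)

text \<open>The summand of (iii), with \<open>p = m\<close> and \<open>s = r\<close>, and of (iv),
  with \<open>p = m - i\<close> and \<open>s = i * k + r\<close>. Real powers are used because the
  exponent \<open>p - s - 2\<close> is negative for \<open>s = p - 1\<close> and
  \<open>s = p\<close>.\<close>

definition psi_term :: "int \<Rightarrow> int \<Rightarrow> real" where
  "psi_term p s = (-1) powi s * (real_of_int (psi (p - 1) (s - 1)) * 2 powi (p - s)
             + real_of_int (psi (p - 1) s) * 2 powi (p - s - 2))"

lemma psi_term_eq_0: "s < -1 \<or> s > p \<Longrightarrow> psi_term p s = 0"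
  by (auto simp: psi_term_def psi_eq_0)

lemma psi_term_minus_1: "p \<ge> 0 \<Longrightarrow> psi_term p (-1) = - (2 powi (p - 1))"
  by (simp add: psi_term_def psi_eq_0 psi_minus_1)

text \<open>Pascal's rule splits both \<open>psi\<close> factors. The halves keeping their lower
  index give twice the term at \<open>(p - 1, s)\<close>, since the exponents drop by one; the other
  halves give the term at \<open>(p - 1, s - 1)\<close>, with equal exponents and opposite
  sign.\<close>

lemma psi_term_rec:
  assumes "p \<ge> 2"
  shows "psi_term p s = 2 * psi_term (p - 1) s - psi_term (p - 1) (s - 1)"
proof -
  have p1: "psi (p - 1) (s - 1) = psi (p - 2) (s - 1) + psi (p - 2) (s - 2)"
    and p2: "psi (p - 1) s = psi (p - 2) s + psi (p - 2) (s - 1)"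
    using psi_pascal[of "p - 1"] assms by simp_all
  \<comment> \<open>The smallest power of 2 that occurs; all others are integer multiples of
    it.\<close>
  define t :: real where "t = 2 powi (p - s - 3)"
  have t: "2 powi (p - s) = 8 * t" "2 powi (p - s - 2) = 2 * t" "2 powi (p - 1 - s) = 4 * t"
    "2 powi (p - 1 - s - 2) = t" "2 powi (p - 1 - (s - 1)) = 8 * t"
    "2 powi (p - 1 - (s - 1) - 2) = 2 * t"
    unfolding t_def by (simp_all add: power_int_diff power_int_add field_simps)
  have u: "(-1 :: real) powi (s - 1) = - ((-1) powi s)"
    by (simp add: power_int_diff)
  have d: "p - 1 - 1 = p - 2" "s - 1 - 1 = s - 2" by simp_all
  show ?thesis
    unfolding psi_term_def u t p1 p2 d by (simp add: algebra_simps)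
qed

section \<open>The sum over representations and its recurrence\<close>

text \<open>The cutoff \<open>n + 1\<close> loses no term when \<open>k \<ge> 1\<close>: a nonzero
  term has \<open>n - p * k \<ge> -1\<close>, so \<open>p \<le> p * k \<le> n + 1\<close>.\<close>

definition psi_sum :: "nat \<Rightarrow> int \<Rightarrow> real" where
  "psi_sum k n = (\<Sum>p = 0..n + 1. psi_term p (n - p * int k))"

text \<open>Terms outside the window \<open>-1 \<le> s \<le> p\<close> vanish, so any finite set of
  nonnegative \<open>p\<close> covering the window serves as index set. All later changes of range
  rest on this.\<close>

lemma psi_sum_eq_sum:
  assumes "k \<ge> 1" "finite A"
    and pos: "\<And>p. p \<in> A \<Longrightarrow> p \<ge> 0"
    and supp: "\<And>p. p \<ge> 0 \<Longrightarrow> -1 \<le> n - p * int k \<Longrightarrow> n - p * int k \<le> p \<Longrightarrow> p \<in> A"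
  shows "psi_sum k n = (\<Sum>p\<in>A. psi_term p (n - p * int k))"
  unfolding psi_sum_def
proof (rule sum.mono_neutral_cong)
  fix p assume "p \<in> A - {0..n + 1}"
  then have "p \<ge> 0" "p > n + 1" using pos by auto
  moreover have "p * 1 \<le> p * int k" using \<open>p \<ge> 0\<close> assms(1) by (intro mult_left_mono) auto
  ultimately show "psi_term p (n - p * int k) = 0" by (intro psi_term_eq_0) auto
next
  fix p assume "p \<in> {0..n + 1} - A"
  then show "psi_term p (n - p * int k) = 0" using supp[of p] by (intro psi_term_eq_0) force
qed (use assms(2) in auto)

lemma psi_sum_rec:
  assumes "k \<ge> 1" "n \<ge> int k + 2"
  shows "psi_sum k n = 2 * psi_sum k (n - int k) - psi_sum k (n - int k - 1)"
proof -
  have "psi_sum k n = (\<Sum>p\<in>{2..n + 1}. psi_term p (n - p * int k))"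
  proof (rule psi_sum_eq_sum)
    fix p assume p: "p \<ge> 0" "-1 \<le> n - p * int k" "n - p * int k \<le> p"
    have "p * 1 \<le> p * int k" using p assms(1) by (intro mult_left_mono) auto
    \<comment> \<open>For \<open>p = 0\<close> and \<open>p = 1\<close> the value of
      \<open>s\<close> is \<open>n\<close> and \<open>n - k \<ge> 2\<close>, above the window. So
      \<open>psi_term_rec\<close> applies to every remaining term.\<close>
    moreover have "p \<noteq> 0" "p \<noteq> 1" using p assms(2) by auto
    ultimately have "2 \<le> p" "p \<le> n + 1" using p by linarith+
    then show "p \<in> {2..n + 1}" by simp
  qed (use assms in auto)
  also have "\<dots> = (\<Sum>q\<in>{1..n}. psi_term (q + 1) (n - (q + 1) * int k))"
    by (rule sum.reindex_bij_witness[of _ "\<lambda>q. q + 1" "\<lambda>p. p - 1"]) auto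
  also have "\<dots> = (\<Sum>q\<in>{1..n}. 2 * psi_term q (n - int k - q * int k) - psi_term q (n - int k - 1 - q * int k))"
    by (rule sum.cong) (auto simp: psi_term_rec algebra_simps)
  also have "\<dots> = 2 * (\<Sum>q\<in>{1..n}. psi_term q (n - int k - q * int k))
      - (\<Sum>q\<in>{1..n}. psi_term q (n - int k - 1 - q * int k))"
    by (simp add: sum_subtractf sum_distrib_left)
  also have "(\<Sum>q\<in>{1..n}. psi_term q (n - int k - q * int k)) = psi_sum k (n - int k)"
  proof (rule psi_sum_eq_sum[symmetric])
    fix p assume p: "p \<ge> 0" "-1 \<le> n - int k - p * int k" "n - int k - p * int k \<le> p"
    have "p * 1 \<le> p * int k" using p assms(1) by (intro mult_left_mono) auto
    moreover have "p \<noteq> 0" using p assms(2) by auto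
    ultimately have "1 \<le> p" "p \<le> n" using p assms by linarith+
    then show "p \<in> {1..n}" by simp
  qed (use assms in auto)
  also have "(\<Sum>q\<in>{1..n}. psi_term q (n - int k - 1 - q * int k)) = psi_sum k (n - int k - 1)"
  proof (rule psi_sum_eq_sum[symmetric])
    fix p assume p: "p \<ge> 0" "-1 \<le> n - int k - 1 - p * int k" "n - int k - 1 - p * int k \<le> p"
    have "p * 1 \<le> p * int k" using p assms(1) by (intro mult_left_mono) auto
    \<comment> \<open>Here \<open>n - k - 1 \<ge> 1\<close>, so \<open>p = 0\<close> again lies
      outside the window.\<close>
    moreover have "p \<noteq> 0" using p assms(2) by auto
    ultimately have "1 \<le> p" "p \<le> n" using p assms by linarith+
    then show "p \<in> {1..n}" by simp
  qed (use assms in auto)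
  finally show ?thesis .
qed

section \<open>Three-term recurrence and initial values of Q\<close>

text \<open>Beyond its first term, the sum for index \<open>n\<close> runs over the indices
  \<open>n - 2\<close> down to \<open>n - k\<close>; the recurrence at \<open>n - 1\<close>
  evaluates that tail.\<close>

lemma lucas_three_term:
  assumes "k \<ge> 2"
  shows "lucas k n = 2 * lucas k (n - 1) - lucas k (n - 1 - int k)"
proof -
  obtain k' where k: "k = Suc k'" using assms by (cases k) auto
  have "lucas k n = (\<Sum>j = 1..Suc k'. lucas k (n - int j))"
    using lucas_forward[OF assms, of n] k by simp
  also have "\<dots> = lucas k (n - 1) + (\<Sum>j = Suc 1..Suc k'. lucas k (n - int j))"
    by (subst sum.atLeast_Suc_atMost) auto
  also have "(\<Sum>j = Suc 1..Suc k'. lucas k (n - int j)) = (\<Sum>j = 1..k'. lucas k (n - 1 - int j))"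
    by (subst sum.shift_bounds_cl_Suc_ivl) (simp add: algebra_simps)
  finally show ?thesis
    using lucas_backward[OF assms, of "n - 1"] k by simp
qed

lemma lucas_neg_rec:
  assumes "k \<ge> 2"
  shows "lucas_neg k n = 2 * lucas_neg k (n - int k) - lucas_neg k (n - int k - 1)"
  using lucas_three_term[OF assms, of "int k + 1 - n"]
  by (simp add: lucas_neg_def algebra_simps)

lemma lucas_neg_0: "k \<ge> 2 \<Longrightarrow> lucas_neg k 0 = 2"
  by (simp add: lucas_neg_def lucas_0)

lemma lucas_neg_initial: "k \<ge> 2 \<Longrightarrow> 1 \<le> n \<Longrightarrow> n \<le> int k - 2 \<Longrightarrow> lucas_neg k n = 0"
  by (simp add: lucas_neg_def lucas_initial)

lemma lucas_neg_k_minus_1: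
  assumes "k \<ge> 2"
  shows "lucas_neg k (int k - 1) = -1"
proof -
  \<comment> \<open>Only \<open>j = 1\<close>, the value 2 at index 0, survives; the other indices
    lie in the block of initial zeros.\<close>
  have "(\<Sum>j = 1..k - 1. lucas k (1 - int j)) = (\<Sum>j\<in>{1}. lucas k (1 - int j))"
    using assms by (intro sum.mono_neutral_right) (auto intro!: lucas_initial)
  then show ?thesis
    using lucas_backward[OF assms, of 1] assms by (simp add: lucas_neg_def lucas_0 lucas_1)
qed

lemma lucas_neg_k:
  assumes "k \<ge> 2"
  shows "lucas_neg k (int k) = 3"
proof -
  \<comment> \<open>Only \<open>j = k - 1\<close> falls just below the block of initial
    zeros.\<close>
  have "(\<Sum>j = 1..k - 1. lucas k (- int j)) = (\<Sum>j\<in>{k - 1}. lucas k (- int j))"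
    using assms by (intro sum.mono_neutral_right) (auto intro!: lucas_initial)
  moreover have "- int (k - 1) = - (int k - 1)" using assms by auto
  ultimately show ?thesis
    using lucas_backward[OF assms, of 0] lucas_neg_k_minus_1[OF assms]
    by (simp add: lucas_neg_def lucas_0[OF assms])
qed

section \<open>Agreement of Q with the sum\<close>

lemma psi_sum_initial:
  assumes "k \<ge> 2" "1 \<le> n" "n \<le> int k + 1"
  shows "psi_sum k n = real_of_int (lucas_neg k n)"
proof -
  \<comment> \<open>From \<open>p * k \<le> n + 1 \<le> k + 2\<close>: \<open>p = 2\<close> forces
    \<open>k = 2\<close> and \<open>n = 3\<close>, and \<open>p \<ge> 3\<close> is
    impossible.\<close>
  have le: "p \<le> 1 \<or> p = 2 \<and> k = 2 \<and> n = 3" if "-1 \<le> n - p * int k" for p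
  proof (rule ccontr)
    assume c: "\<not> ?thesis"
    then consider "p = 2" | "p \<ge> 3" by linarith
    then show False
    proof cases
      case 2
      then have "3 * int k \<le> p * int k" by (intro mult_right_mono) auto
      then show False using that assms by linarith
    qed (use c that assms in auto)
  qed
  have S: "psi_sum k n = (\<Sum>p\<in>{1, 2}. psi_term p (n - p * int k))"
  proof (rule psi_sum_eq_sum)
    fix p assume p: "p \<ge> 0" "-1 \<le> n - p * int k" "n - p * int k \<le> p"
    then have "p \<noteq> 0" using assms(2) by auto
    then show "p \<in> {1, 2}" using le[OF p(2)] p(1) by auto
  qed (use assms in auto)
  have G1: "psi_term 1 0 = 3" "psi_term 1 1 = -2" "psi_term 1 (-1) = -1" "psi_term 2 (-1) = -2"
    by (simp_all add: psi_term_def psi_def ibinom_def power_int_minus)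
  consider "n \<le> int k - 2" | "n = int k - 1" | "n = int k" | "n = int k + 1" using assms by linarith
  then show ?thesis
  proof cases
    case 1
    then show ?thesis unfolding S using assms by (simp add: psi_term_eq_0 lucas_neg_initial)
  next
    case 2
    then show ?thesis unfolding S using assms by (simp add: psi_term_eq_0 G1 lucas_neg_k_minus_1)
  next
    case 3
    then show ?thesis unfolding S using assms by (simp add: psi_term_eq_0 G1 lucas_neg_k)
  next
    case 4
    \<comment> \<open>The value at 1 is 0 for \<open>k > 2\<close> but -1 for \<open>k = 2\<close>;
      in the latter case the extra term \<open>psi_term 2 (-1) = -2\<close> makes up the
      difference.\<close>
    have r: "lucas_neg k n = 2 * lucas_neg k 1 - 2"
      using lucas_neg_rec[OF assms(1), of n] 4 assms(1) by (simp add: lucas_neg_0)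
    show ?thesis
    proof (cases "k = 2")
      case True
      then show ?thesis unfolding S using r 4 lucas_neg_k_minus_1[OF assms(1)] by (simp add: G1)
    next
      case False
      then show ?thesis unfolding S using r 4 assms by (simp add: psi_term_eq_0 G1 lucas_neg_initial)
    qed
  qed
qed

text \<open>Strong induction with the \<open>k + 1\<close> base values from
  \<open>psi_sum_initial\<close>. The range starts at 1 because at 0 the sides differ:
  \<open>lucas_neg k 0\<close> is 2, \<open>psi_sum k 0\<close> is 1.\<close>

lemma lucas_neg_eq_psi_sum:
  assumes "k \<ge> 2" "1 \<le> n"
  shows "real_of_int (lucas_neg k n) = psi_sum k n"
  using assms(2)
proof (induction "nat n" arbitrary: n rule: less_induct)
  case less
  show ?case
  proof (cases "n \<le> int k + 1")
    case True
    then show ?thesis using psi_sum_initial less.prems assms(1) by simp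
  next
    case False
    then have "real_of_int (lucas_neg k (n - int k)) = psi_sum k (n - int k)"
      "real_of_int (lucas_neg k (n - int k - 1)) = psi_sum k (n - int k - 1)"
      using assms(1) by (auto intro!: less.hyps)
    then show ?thesis
      using psi_sum_rec[of k n] lucas_neg_rec[OF assms(1), of n] False assms(1) by simp
  qed
qed

section \<open>The four formulas\<close>

lemma lucas_neg_eq_sum:
  assumes "k \<ge> 2" "1 \<le> m * int k + r" "r \<le> int k - 2" "finite I"
    and le: "\<And>i. i \<in> I \<Longrightarrow> i \<le> m"
    and supp: "\<And>i. 0 \<le> i \<Longrightarrow> i \<le> m \<Longrightarrow> i * int k + r \<le> m - i \<Longrightarrow> i \<in> I"
  shows "real_of_int (lucas_neg k (m * int k + r)) = (\<Sum>i\<in>I. psi_term (m - i) (i * int k + r))"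
proof -
  have eq: "m * int k + r - p * int k = (m - p) * int k + r" for p
    by (simp add: algebra_simps)
  have "psi_sum k (m * int k + r) = (\<Sum>p\<in>(\<lambda>i. m - i) ` I. psi_term p (m * int k + r - p * int k))"
  proof (rule psi_sum_eq_sum)
    fix p assume p: "p \<ge> 0" "-1 \<le> m * int k + r - p * int k" "m * int k + r - p * int k \<le> p"
    have "p \<le> m"
    proof (rule ccontr)
      assume "\<not> p \<le> m"
      \<comment> \<open>Since \<open>r \<le> k - 2\<close>, any \<open>p > m\<close> would give
        \<open>s \<le> r - k \<le> -2\<close>, below the window.\<close>
      then have "(m - p) * int k \<le> (-1) * int k" by (intro mult_right_mono) auto
      then show False using p(2) assms(3) unfolding eq by linarith
    qed
    then have "m - p \<in> I" using p(1,3) unfolding eq by (intro supp) auto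
    then show "p \<in> (\<lambda>i. m - i) ` I" by (intro image_eqI[of _ _ "m - p"]) auto
  qed (use assms in auto)
  also have "\<dots> = (\<Sum>i\<in>I. psi_term (m - i) (i * int k + r))"
    by (subst sum.reindex) (auto simp: inj_on_def algebra_simps intro!: sum.cong)
  finally show ?thesis using lucas_neg_eq_psi_sum[OF assms(1,2)] by simp
qed

text \<open>For \<open>m \<le> k - 2\<close> only \<open>i = 0\<close> contributes:
  \<open>i \<ge> 1\<close> gives \<open>s \<ge> k - 1 > m - i\<close>. Formulas (i) to (iii) are the
  cases \<open>r > m\<close>, \<open>r = -1\<close> and \<open>0 \<le> r \<le> m\<close>.\<close>

lemma lucas_neg_eq_psi_term:
  assumes "k \<ge> 2" "1 \<le> m * int k + r" "-1 \<le> r" "r \<le> int k - 2" "0 \<le> m" "m \<le> int k - 2"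
  shows "real_of_int (lucas_neg k (m * int k + r)) = psi_term m r"
proof -
  have "real_of_int (lucas_neg k (m * int k + r)) = (\<Sum>i\<in>{0}. psi_term (m - i) (i * int k + r))"
  proof (rule lucas_neg_eq_sum)
    fix i assume i: "0 \<le> i" "i \<le> m" "i * int k + r \<le> m - i"
    show "i \<in> {0}"
    proof (rule ccontr)
      assume "i \<notin> {0}"
      then have "1 * int k \<le> i * int k" using i(1) by (intro mult_right_mono) auto
      then show False using i assms by linarith
    qed
  qed (use assms in auto)
  then show ?thesis by simp
qed

theorem theorem1p2:
  fixes k :: nat
  assumes "k \<ge> 2"
  shows
    "(\<forall>m r :: int. 0 \<le> m \<and> m < r \<and> r \<le> int k - 2 \<longrightarrow> lucas_neg k (m * int k + r) = 0)
   \<and> (\<forall>m :: int. 1 \<le> m \<and> m \<le> int k - 2 \<longrightarrow>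
        real_of_int (lucas_neg k (m * int k - 1)) = - ((2::real) powi (m - 1)))
   \<and> (\<forall>m r :: int. 0 \<le> r \<and> r \<le> m \<and> m \<le> int k - 2 \<and> 1 \<le> m \<longrightarrow>
        real_of_int (lucas_neg k (m * int k + r)) =
          (-1) powi r *
            (real_of_int (psi (m - 1) (r - 1)) * 2 powi (m - r)
             + real_of_int (psi (m - 1) r) * 2 powi (m - r - 2)))
   \<and> (\<forall>m r l :: int. -1 \<le> r \<and> r \<le> int k - 2 \<and> max 1 (int k - 2) \<le> m \<and>
        l = (if k = 2 then m else \<lfloor>real_of_int (m + 1) / real_of_int (int k - 1)\<rfloor>) \<longrightarrow>
        real_of_int (lucas_neg k (m * int k + r)) =
          (\<Sum>i = 0..l. (-1) powi (i * int k + r) *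
            (real_of_int (psi (m - i - 1) (i * int k + r - 1)) * 2 powi (m - i * (int k + 1) - r)
             + real_of_int (psi (m - i - 1) (i * int k + r)) * 2 powi (m - i * (int k + 1) - r - 2))))"
  (is "?P1 \<and> ?P2 \<and> ?P3 \<and> ?P4")
proof (intro conjI)
  have pos: "1 \<le> m * int k + r" if "1 \<le> m" "-1 \<le> r" for m r :: int
  proof -
    have "1 * int k \<le> m * int k" using that by (intro mult_right_mono) auto
    then show ?thesis using that assms by linarith
  qed
  show ?P1
  proof (intro allI impI)
    fix m r :: int
    assume a: "0 \<le> m \<and> m < r \<and> r \<le> int k - 2"
    \<comment> \<open>Here \<open>m\<close> may be 0, so positivity of the index comes from
      \<open>r > m\<close> instead of \<open>pos\<close>.\<close>
    have "0 \<le> m * int k" using a by simp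
    then have "1 \<le> m * int k + r" using a by linarith
    then have "real_of_int (lucas_neg k (m * int k + r)) = 0"
      using lucas_neg_eq_psi_term[OF assms, of m r] a by (simp add: psi_term_eq_0)
    then show "lucas_neg k (m * int k + r) = 0" by simp
  qed
  show ?P2
    using lucas_neg_eq_psi_term[OF assms, of _ "-1"] pos[of _ "-1"] assms by (auto simp: psi_term_minus_1)
  show ?P3
    using lucas_neg_eq_psi_term[OF assms] pos by (auto simp: psi_term_def)
  show ?P4
  proof (intro allI impI)
    fix m r l :: int
    assume a: "-1 \<le> r \<and> r \<le> int k - 2 \<and> max 1 (int k - 2) \<le> m \<and>
      l = (if k = 2 then m else \<lfloor>real_of_int (m + 1) / real_of_int (int k - 1)\<rfloor>)"
    have l: "l = (m + 1) div (int k - 1)" if "k \<noteq> 2"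
      using a that by (simp only: floor_divide_of_int_eq if_False)
    \<comment> \<open>This keeps \<open>p = m - i\<close> nonnegative. At \<open>k = 2\<close> the
      quotient would be \<open>m + 1\<close>, hence the separate value of \<open>l\<close>; for
      \<open>k > 2\<close> the divisor is at least 2.\<close>
    have "l \<le> m"
    proof (cases "k = 2")
      case False
      have "(m + 1) div (int k - 1) \<le> (m + 1) div 2"
        using False assms a by (intro zdiv_mono2) auto
      also have "\<dots> \<le> m" using a by auto
      finally show ?thesis using l[OF False] by simp
    qed (use a in simp)
    have "real_of_int (lucas_neg k (m * int k + r)) = (\<Sum>i\<in>{0..l}. psi_term (m - i) (i * int k + r))"
    proof (rule lucas_neg_eq_sum)
      fix i assume i: "0 \<le> i" "i \<le> m" "i * int k + r \<le> m - i"
      \<comment> \<open>The window condition and \<open>r \<ge> -1\<close> give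
        \<open>i * (k + 1) \<le> m + 1\<close>, hence
        \<open>i * (k - 1) \<le> m + 1\<close>.\<close>
      have "i \<le> l"
      proof (cases "k = 2")
        case False
        have "i * (int k - 1) \<le> m + 1" using i a by (simp add: algebra_simps)
        then have "i * (int k - 1) div (int k - 1) \<le> (m + 1) div (int k - 1)"
          using assms by (intro zdiv_mono1) auto
        then show ?thesis using l[OF False] assms by simp
      qed (use i a in simp)
      then show "i \<in> {0..l}" using i by simp
    qed (use assms a pos \<open>l \<le> m\<close> in auto)
    moreover have "m - i - (i * int k + r) = m - i * (int k + 1) - r" for i
      by (simp add: algebra_simps)
    ultimately show "real_of_int (lucas_neg k (m * int k + r)) =
          (\<Sum>i = 0..l. (-1) powi (i * int k + r) *
            (real_of_int (psi (m - i - 1) (i * int k + r - 1)) * 2 powi (m - i * (int k + 1) - r)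
             + real_of_int (psi (m - i - 1) (i * int k + r)) * 2 powi (m - i * (int k + 1) - r - 2)))"
      by (simp add: psi_term_def)
  qed
qed

end
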